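(* Let $X$ be a complex Banach space with open unit ball $\mathbb{B}$, let $f:\mathbb{B}\to\mathbb{C}$ be holomorphic, and let $F:\mathbb{B}\to X$ be given by $F(x)=f(x)x$. For each $u\in\partial\mathbb{B}$ put $f_u(\zeta)=\zeta f(\zeta u)$, $|\zeta|<1$. Let $r\in(0,1)$ be fixed. Then $F$ is a biholomorphic mapping on $B_r$ if and only if $f_u$ is univalent on $\mathbb{U}_r$ for all $u\in\partial\mathbb{B}$.
   Context: $B_r=\{x\in X:\|x\|<r\}$, $\mathbb{U}_r=\{\zeta\in\mathbb{C}:|\zeta|<r\}$, $\partial\mathbb{B}=\{x\in X:\|x\|=1\}$. A holomorphic mapping $F$ on a domain $D\subset X$ is biholomorphic on $D$ if it is injective on $D$, $F(D)$ is open, and the inverse $F(D)\to D$ is holomorphic. "Univalent" means holomorphic and injective. *)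

theory Defs
  imports "HOL-Complex_Analysis.Complex_Analysis"
begin

text \<open>
  The distribution has only real normed spaces as type classes. A complex normed space is
  rendered as a real normed space with a complex scalar multiplication that extends the real
  one and for which the norm is homogeneous.
\<close>

class complex_normed_vector = real_normed_vector +
  fixes scaleC :: "complex \<Rightarrow> 'a \<Rightarrow> 'a"  (infixr "*\<^sub>C" 75)
  assumes scaleC_add_right: "a *\<^sub>C (x + y) = a *\<^sub>C x + a *\<^sub>C y"
    and scaleC_add_left: "(a + b) *\<^sub>C x = a *\<^sub>C x + b *\<^sub>C x"
    and scaleC_scaleC: "a *\<^sub>C b *\<^sub>C x = (a * b) *\<^sub>C x"
    and scaleC_one: "1 *\<^sub>C x = x"
    and scaleR_scaleC: "t *\<^sub>R x = complex_of_real t *\<^sub>C x"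
    and norm_scaleC: "norm (a *\<^sub>C x) = cmod a * norm x"

class complex_banach = complex_normed_vector + complete_space

subclass (in complex_banach) banach ..

instantiation complex :: complex_banach
begin

definition scaleC_complex :: "complex \<Rightarrow> complex \<Rightarrow> complex"
  where "scaleC_complex a z = a * z"

instance
  by standard (simp_all add: scaleC_complex_def algebra_simps norm_mult scaleR_conv_of_real)

end

lemma vector_space_scaleC:
  "vector_space (scaleC :: complex \<Rightarrow> 'a \<Rightarrow> 'a::complex_normed_vector)"
  by (simp add: vector_space_def scaleC_add_right scaleC_add_left scaleC_scaleC scaleC_one)

text \<open>
  Holomorphy is complex Frechet differentiability: the real Frechet derivative (which is bounded
  by definition) exists and is complex linear.
\<close>

definition holomorphic_map ::
    "('a::complex_normed_vector \<Rightarrow> 'b::complex_normed_vector) \<Rightarrow> 'a set \<Rightarrow> bool"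
  where "holomorphic_map F D \<longleftrightarrow> open D \<and>
    (\<forall>x\<in>D. \<exists>F'. (F has_derivative F') (at x) \<and> Vector_Spaces.linear scaleC scaleC F')"

definition biholomorphic_map ::
    "('a::complex_normed_vector \<Rightarrow> 'b::complex_normed_vector) \<Rightarrow> 'a set \<Rightarrow> bool"
  where "biholomorphic_map F D \<longleftrightarrow> holomorphic_map F D \<and> inj_on F D \<and> open (F ` D) \<and>
    holomorphic_map (inv_into D F) (F ` D)"

definition univalent_on :: "(complex \<Rightarrow> complex) \<Rightarrow> complex set \<Rightarrow> bool"
  where "univalent_on g S \<longleftrightarrow> g holomorphic_on S \<and> inj_on g S"

lemma holomorphic_map_complex_iff:
  fixes g :: "complex \<Rightarrow> complex"
  shows "holomorphic_map g S \<longleftrightarrow> open S \<and> g holomorphic_on S"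
proof -
  have lin: "Vector_Spaces.linear scaleC scaleC L \<longleftrightarrow> (\<exists>c. L = (*) c)"
    for L :: "complex \<Rightarrow> complex"
  proof -
    have "L = (*) (L 1)" if "\<forall>c x. L (c * x) = c * L x"
      using spec[OF that] by (metis ext mult.commute mult.right_neutral)
    then show ?thesis
      by (auto simp: Vector_Spaces.linear_iff vector_space_scaleC scaleC_complex_def algebra_simps)
  qed
  show ?thesis
    unfolding holomorphic_map_def lin
    by (auto simp: holomorphic_on_open has_field_derivative_def; blast)
qed

end

theory Submission
  imports Defs
begin

text \<open>
  On the line through \<open>u\<close> the map \<open>F x = f x *\<^sub>C x\<close> acts as \<open>f_u\<close>, so injectivity of \<open>F\<close> on the ball
  is injectivity of all \<open>f_u\<close>. The derivative of \<open>F\<close> at \<open>x\<close> is \<open>h \<mapsto> f x *\<^sub>C h + f' h *\<^sub>C x\<close>, a rank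
  one perturbation of a multiple of the identity; it has an explicit bounded inverse as soon as
  \<open>f x \<noteq> 0\<close> and \<open>f x + f' x \<noteq> 0\<close>, and these two numbers are the quotient \<open>f_u \<zeta> / \<zeta>\<close> and the
  derivative of \<open>f_u\<close>, which do not vanish for univalent \<open>f_u\<close>.

  No inverse function theorem in Banach spaces is needed: preimages of \<open>y\<close> under \<open>F\<close> have the form
  \<open>\<lambda> *\<^sub>C y\<close> with \<open>\<lambda> * f (\<lambda> *\<^sub>C y) = 1\<close>, so the openness of \<open>F\<close> follows from a Hurwitz argument in the
  single complex variable \<open>\<lambda>\<close>, uniformly for \<open>y\<close> near a given point. The inverse is therefore
  continuous, and a continuous inverse is differentiable wherever the derivative is invertible.
\<close>

section \<open>Complex scalar multiplication and complex linear derivatives\<close>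

lemma bounded_bilinear_scaleC:
  "bounded_bilinear (scaleC :: complex \<Rightarrow> 'a \<Rightarrow> 'a::complex_normed_vector)"
proof
  fix a b :: complex and x y :: 'a and t :: real
  show "(a + b) *\<^sub>C x = a *\<^sub>C x + b *\<^sub>C x" "a *\<^sub>C (x + y) = a *\<^sub>C x + a *\<^sub>C y"
    by (rule scaleC_add_left scaleC_add_right)+
  show "(t *\<^sub>R a) *\<^sub>C x = t *\<^sub>R a *\<^sub>C x" "a *\<^sub>C t *\<^sub>R x = t *\<^sub>R a *\<^sub>C x"
    by (simp_all add: scaleR_scaleC scaleC_scaleC scaleC_complex_def mult.commute)
  show "\<exists>K. \<forall>a (x::'a). norm (a *\<^sub>C x) \<le> norm a * norm x * K"
    by (rule exI[of _ 1]) (simp add: norm_scaleC)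
qed

interpretation scaleC: bounded_bilinear
  "scaleC :: complex \<Rightarrow> 'a \<Rightarrow> 'a::complex_normed_vector"
  by (rule bounded_bilinear_scaleC)

lemmas continuous_on_scaleC [continuous_intros] = scaleC.continuous_on

lemma scaleC_eq_0_iff: "a *\<^sub>C x = 0 \<longleftrightarrow> a = 0 \<or> x = (0::'a::complex_normed_vector)"
  using norm_scaleC[of a x] by (metis mult_eq_0_iff norm_eq_zero)

lemma linear_scaleC_iff:
  "Vector_Spaces.linear scaleC scaleC (L :: 'a::complex_normed_vector \<Rightarrow> 'b::complex_normed_vector)
    \<longleftrightarrow> (\<forall>x y. L (x + y) = L x + L y) \<and> (\<forall>c x. L (c *\<^sub>C x) = c *\<^sub>C L x)"
  by (auto simp: Vector_Spaces.linear_iff vector_space_scaleC)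

lemma holomorphic_mapE:
  assumes "holomorphic_map f D" "x \<in> D"
  obtains f' where "(f has_derivative f') (at x)"
    "\<And>x y. f' (x + y) = f' x + f' y" "\<And>c x. f' (c *\<^sub>C x) = c *\<^sub>C f' x"
  using assms unfolding holomorphic_map_def linear_scaleC_iff by blast

lemma holomorphic_map_imp_continuous_on:
  assumes "holomorphic_map f D"
  shows "continuous_on D f"
  using assms unfolding holomorphic_map_def
  by (meson continuous_at_imp_continuous_on has_derivative_continuous)

section \<open>The radial map and its slices along complex lines\<close>

lemma has_derivative_radial:
  assumes "(f has_derivative f') (at x)"
  shows "((\<lambda>x. f x *\<^sub>C x) has_derivative (\<lambda>h. f x *\<^sub>C h + f' h *\<^sub>C x)) (at x)"
  by (rule scaleC.FDERIV[OF assms has_derivative_ident])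

lemma holomorphic_map_radial:
  fixes f :: "'a::complex_normed_vector \<Rightarrow> complex"
  assumes f: "holomorphic_map f D"
  shows "holomorphic_map (\<lambda>x. f x *\<^sub>C x) D"
  unfolding holomorphic_map_def
proof (intro conjI ballI)
  show "open D"
    using f by (simp add: holomorphic_map_def)
  fix x assume "x \<in> D"
  obtain f' where f': "(f has_derivative f') (at x)"
    "\<And>x y. f' (x + y) = f' x + f' y" "\<And>c x. f' (c *\<^sub>C x) = c *\<^sub>C f' x"
    using holomorphic_mapE[OF f \<open>x \<in> D\<close>] by blast
  have "Vector_Spaces.linear scaleC scaleC (\<lambda>h. f x *\<^sub>C h + f' h *\<^sub>C x)"
    unfolding linear_scaleC_iff
    by (simp add: f'(2,3) scaleC_add_left scaleC_add_right scaleC_scaleC scaleC_complex_def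
        mult.commute)
  then show "\<exists>F'. ((\<lambda>x. f x *\<^sub>C x) has_derivative F') (at x) \<and> Vector_Spaces.linear scaleC scaleC F'"
    using has_derivative_radial[OF f'(1)] by blast
qed

text \<open>The product rule gives the extra term \<open>\<zeta> * f' y\<close>, and complex
  linearity moves \<zeta> into the argument of \<open>f'\<close>. Written this way, the derivative
  depends only on the point \<open>x = \<zeta> *\<^sub>C y\<close>, as
  \<open>f x + f' x\<close>.\<close>

lemma has_field_derivative_slice:
  fixes f :: "'a::complex_normed_vector \<Rightarrow> complex"
  assumes f: "(f has_derivative f') (at (\<zeta> *\<^sub>C y))"
    and lin: "\<And>c x. f' (c *\<^sub>C x) = c *\<^sub>C f' x"
  shows "((\<lambda>\<zeta>. \<zeta> * f (\<zeta> *\<^sub>C y)) has_field_derivative f (\<zeta> *\<^sub>C y) + f' (\<zeta> *\<^sub>C y)) (at \<zeta>)"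
proof -
  have "((\<lambda>\<zeta>. \<zeta> *\<^sub>C y) has_derivative (\<lambda>h. h *\<^sub>C y)) (at \<zeta>)"
    by (rule bounded_linear_imp_has_derivative[OF scaleC.bounded_linear_left])
  then have "((\<lambda>\<zeta>. f (\<zeta> *\<^sub>C y)) has_derivative (\<lambda>h. f' (h *\<^sub>C y))) (at \<zeta>)"
    using f by (rule has_derivative_compose)
  then have "((\<lambda>\<zeta>. f (\<zeta> *\<^sub>C y)) has_field_derivative f' y) (at \<zeta>)"
    by (simp add: has_field_derivative_def lin scaleC_complex_def mult.commute[of _ "f' y"])
  then show ?thesis
    by (auto intro!: derivative_eq_intros simp: lin scaleC_complex_def)
qed

lemma holomorphic_on_slice:
  fixes f :: "'a::complex_normed_vector \<Rightarrow> complex"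
  assumes "holomorphic_map f D" "\<And>\<zeta>. \<zeta> \<in> S \<Longrightarrow> \<zeta> *\<^sub>C y \<in> D"
  shows "(\<lambda>\<zeta>. \<zeta> * f (\<zeta> *\<^sub>C y)) holomorphic_on S"
proof (rule holomorphic_onI)
  fix \<zeta> assume "\<zeta> \<in> S"
  with assms(2) have "\<zeta> *\<^sub>C y \<in> D"
    by blast
  with assms(1) obtain f' where "(f has_derivative f') (at (\<zeta> *\<^sub>C y))"
    "\<And>c x. f' (c *\<^sub>C x) = c *\<^sub>C f' x"
    by (metis holomorphic_mapE)
  from has_field_derivative_slice[OF this]
  show "(\<lambda>\<zeta>. \<zeta> * f (\<zeta> *\<^sub>C y)) field_differentiable at \<zeta> within S"
    using field_differentiable_at_within field_differentiable_def by blast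
qed

section \<open>Openness of the radial map and holomorphy of its inverse\<close>

lemma open_image_radial:
  fixes f :: "'a::complex_normed_vector \<Rightarrow> complex"
  assumes f: "holomorphic_map f D"
    and inj: "inj_on (\<lambda>x. f x *\<^sub>C x) D"
    and nz: "\<And>x. x \<in> D \<Longrightarrow> f x \<noteq> 0"
    and U: "open U" "U \<subseteq> D"
  shows "open ((\<lambda>x. f x *\<^sub>C x) ` U)"
proof (subst open_subopen, safe)
  fix x assume x: "x \<in> U"
  define y where "y = f x *\<^sub>C x"
  \<comment> \<open>The coordinate of the known preimage \<open>x\<close> on the line through
    \<open>y\<close>.\<close>
  define c where "c = 1 / f x"
  have fx: "f x \<noteq> 0" and xD: "x \<in> D"
    using x U nz by auto
  have cy: "c *\<^sub>C y = x"
    using fx by (simp add: c_def y_def scaleC_scaleC scaleC_one)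
  have "open ((\<lambda>z. z *\<^sub>C y) -` U)"
    by (rule open_vimage[OF U(1)]) (intro continuous_intros)
  moreover have "c \<in> (\<lambda>z. z *\<^sub>C y) -` U"
    using x cy by simp
  ultimately obtain d where d: "d > 0" "cball c d \<subseteq> (\<lambda>z. z *\<^sub>C y) -` U"
    using open_contains_cball_eq by blast
  define W where "W = (\<lambda>p::'a \<times> complex. snd p *\<^sub>C fst p) -` U"
  have "open W"
    unfolding W_def by (rule open_vimage[OF U(1)]) (intro continuous_intros)
  \<comment> \<open>Compactness of the disc keeps \<open>z *\<^sub>C w\<close> in \<open>U\<close>
    for all \<open>z\<close> in it, uniformly for \<open>w\<close> near \<open>y\<close>.\<close>
  obtain Y1 where Y1: "y \<in> Y1" "open Y1" "Y1 \<times> cball c d \<subseteq> W"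
  proof -
    have "{y} \<times> cball c d \<subseteq> W"
      using d(2) by (auto simp: W_def)
    from Elementary_Topology.tube_lemma[OF compact_cball \<open>open W\<close> this] show ?thesis
      by (elim exE conjE) (rule that)
  qed
  \<comment> \<open>A zero \<open>z\<close> of \<open>h w\<close> yields the preimage
    \<open>z *\<^sub>C w\<close> of \<open>w\<close>.\<close>
  define h where "h = (\<lambda>y z. z * f (z *\<^sub>C y) - 1)"
  define V where "V = Y1 \<times> UNIV \<inter> W"
  have "open V"
    unfolding V_def using \<open>open W\<close> Y1 by (intro open_Int open_Times) auto
  have contf: "continuous_on D f"
    by (rule holomorphic_map_imp_continuous_on[OF f])
  have inD: "snd p *\<^sub>C fst p \<in> D" "c *\<^sub>C fst p \<in> D" if "p \<in> V" for p
    using that U Y1(3) d(1) by (auto simp: V_def W_def subset_iff)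
  have "continuous_on V (\<lambda>p. norm (h (fst p) (snd p)) - norm (h (fst p) c))"
    unfolding h_def
    by (intro continuous_intros continuous_on_compose2[OF contf]) (use inD in auto)
  then have open_less: "open (V \<inter> (\<lambda>p. norm (h (fst p) (snd p)) - norm (h (fst p) c)) -` {0<..})"
    using \<open>open V\<close> by (rule continuous_open_preimage) auto
  have hc: "h y c = 0"
    using fx by (simp add: h_def cy) (simp add: c_def)
  \<comment> \<open>Injectivity makes \<open>c\<close> the only zero of \<open>h y\<close> in the
    disc. Once \<open>z *\<^sub>C y = x\<close>, the equation reads \<open>z * f x = 1\<close>; this
    yields \<open>z = c\<close> without cancelling \<open>y\<close>, which may be 0.\<close>
  have hnz: "h y z \<noteq> 0" if z: "z \<in> cball c d" "z \<noteq> c" for z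
  proof
    assume "h y z = 0"
    then have zf: "z * f (z *\<^sub>C y) = 1"
      by (simp add: h_def)
    have "f (z *\<^sub>C y) *\<^sub>C z *\<^sub>C y = f x *\<^sub>C x"
      using zf unfolding y_def[symmetric] by (simp add: scaleC_scaleC mult.commute scaleC_one)
    moreover have "z *\<^sub>C y \<in> D"
      using z d U by auto
    ultimately have "z *\<^sub>C y = x"
      using inj xD by (meson inj_onD)
    then have "z = c"
      using zf fx by (simp add: c_def field_simps)
    with z show False
      by simp
  qed
  \<comment> \<open>On the circle \<open>h y\<close> is nonzero, while it vanishes at
    \<open>c\<close>. This strict inequality is an open condition, so compactness of the circle
    carries it over to all \<open>w\<close> near \<open>y\<close>.\<close>
  have sphere: "{y} \<times> sphere c d \<subseteq> V \<inter> (\<lambda>p. norm (h (fst p) (snd p)) - norm (h (fst p) c)) -` {0<..}"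
    using hnz hc d Y1 by (auto simp: V_def subset_iff)
  obtain Y2 where Y2: "y \<in> Y2" "open Y2"
    "Y2 \<times> sphere c d \<subseteq> V \<inter> (\<lambda>p. norm (h (fst p) (snd p)) - norm (h (fst p) c)) -` {0<..}"
    using Elementary_Topology.tube_lemma[OF compact_sphere open_less sphere]
    by (elim exE conjE) (rule that)
  have "Y1 \<inter> Y2 \<subseteq> (\<lambda>x. f x *\<^sub>C x) ` U"
  proof
    fix w assume w: "w \<in> Y1 \<inter> Y2"
    have wU: "z *\<^sub>C w \<in> U" if "z \<in> cball c d" for z
      using that w Y1(3) by (auto simp: W_def subset_iff)
    have hol: "h w holomorphic_on cball c d"
      unfolding h_def using wU U
      by (intro holomorphic_intros holomorphic_on_slice[OF f]) auto
    have less: "norm (h w c) < norm (h w z)" if "norm (c - z) = d" for z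
      using that Y2(3) w by (auto simp: dist_norm subset_iff)
    \<comment> \<open>Minimum modulus: a holomorphic function that is smaller at the centre than
      everywhere on the circle has a zero inside.\<close>
    obtain z where z: "z \<in> ball c d" "h w z = 0"
      by (rule holomorphic_contract_to_zero[OF holomorphic_on_imp_continuous_on[OF hol]
            holomorphic_on_subset[OF hol ball_subset_cball] d(1) less])
    have "f (z *\<^sub>C w) *\<^sub>C z *\<^sub>C w = w"
      using z(2) by (simp add: h_def scaleC_scaleC mult.commute scaleC_one)
    moreover have "z *\<^sub>C w \<in> U"
      using z wU by auto
    ultimately show "w \<in> (\<lambda>x. f x *\<^sub>C x) ` U"
      by (rule image_eqI[OF sym])
  qed
  then show "\<exists>T. open T \<and> f x *\<^sub>C x \<in> T \<and> T \<subseteq> (\<lambda>x. f x *\<^sub>C x) ` U"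
    using Y1 Y2 by (intro exI[of _ "Y1 \<inter> Y2"]) (auto simp: y_def[symmetric])
qed

text \<open>The derivative at \<open>x\<close> multiplies the kernel of \<open>f'\<close> by
  \<open>f x\<close> and the vector \<open>x\<close> by \<open>f x + f' x\<close>, so
  \<open>nz\<close> and \<open>reg\<close> make it invertible.\<close>

lemma biholomorphic_map_radial:
  fixes f :: "'a::complex_normed_vector \<Rightarrow> complex"
  assumes f: "holomorphic_map f D"
    and inj: "inj_on (\<lambda>x. f x *\<^sub>C x) D"
    and nz: "\<And>x. x \<in> D \<Longrightarrow> f x \<noteq> 0"
    and reg: "\<And>x f'. x \<in> D \<Longrightarrow> (f has_derivative f') (at x) \<Longrightarrow>
      (\<And>c h. f' (c *\<^sub>C h) = c *\<^sub>C f' h) \<Longrightarrow> f x + f' x \<noteq> 0"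
  shows "biholomorphic_map (\<lambda>x. f x *\<^sub>C x) D"
proof -
  define F where "F = (\<lambda>x. f x *\<^sub>C x)"
  define G where "G = inv_into D F"
  have "open D"
    using f by (simp add: holomorphic_map_def)
  have open_image: "open (F ` U)" if "open U" "U \<subseteq> D" for U
    unfolding F_def by (rule open_image_radial[OF f inj nz that])
  have holF: "holomorphic_map F D"
    unfolding F_def by (rule holomorphic_map_radial[OF f])
  have GF: "G (F x) = x" if "x \<in> D" for x
    unfolding G_def using inj[folded F_def] that by (rule inv_into_f_f)
  have openFD: "open (F ` D)"
    by (rule open_image[OF \<open>open D\<close> order_refl])
  have contG: "continuous_on (F ` D) G"
  proof (rule continuous_on_inverse_open_map[OF holomorphic_map_imp_continuous_on[OF holF] refl GF])
    fix U assume "openin (top_of_set D) U"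
    then have "open U" "U \<subseteq> D"
      using \<open>open D\<close> openin_open_eq by blast+
    then show "openin (top_of_set (F ` D)) (F ` U)"
      using open_image openFD by (simp add: openin_open_eq image_mono)
  qed
  have "holomorphic_map G (F ` D)"
    unfolding holomorphic_map_def
  proof (intro conjI ballI openFD)
    fix y assume y: "y \<in> F ` D"
    then obtain x where x: "x \<in> D" "y = F x"
      by blast
    have Gy: "G y = x"
      using x GF by simp
    obtain f' where f': "(f has_derivative f') (at x)"
      "\<And>x y. f' (x + y) = f' x + f' y" "\<And>c x. f' (c *\<^sub>C x) = c *\<^sub>C f' x"
      using holomorphic_mapE[OF f x(1)] by blast
    define a where "a = f x"
    define b where "b = f x + f' x"
    have ab: "a \<noteq> 0" "b \<noteq> 0"
      using nz[OF x(1)] reg[OF x(1) f'(1,3)] by (simp_all add: a_def b_def)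
    \<comment> \<open>To solve \<open>a *\<^sub>C h + f' h *\<^sub>C x = k\<close> for
      \<open>h\<close>, apply \<open>f'\<close>: this gives \<open>b * f' h = f' k\<close>, and
      \<open>h\<close> follows by substitution.\<close>
    define G' where "G' = (\<lambda>k. (1 / a) *\<^sub>C (k - (f' k / b) *\<^sub>C x))"
    have "bounded_linear f'"
      using f'(1) by (rule has_derivative_bounded_linear)
    then have "bounded_linear (\<lambda>k. f' k / b)"
      by (rule bounded_linear_compose[OF bounded_linear_divide])
    then have "bounded_linear (\<lambda>k. (f' k / b) *\<^sub>C x)"
      by (rule bounded_linear_compose[OF scaleC.bounded_linear_left])
    then have "bounded_linear (\<lambda>k. k - (f' k / b) *\<^sub>C x)"
      by (rule bounded_linear_sub[OF bounded_linear_ident])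
    then have blG': "bounded_linear G'"
      unfolding G'_def by (rule bounded_linear_compose[OF scaleC.bounded_linear_right])
    have linG': "Vector_Spaces.linear scaleC scaleC G'"
      unfolding linear_scaleC_iff
    proof (intro conjI allI)
      show "G' (k + l) = G' k + G' l" for k l
        using blG' by (simp add: linear_simps)
      show "G' (c *\<^sub>C k) = c *\<^sub>C G' k" for c k
        by (simp add: G'_def f'(3) scaleC_complex_def scaleC.diff_right scaleC_scaleC mult.commute)
    qed
    have inv: "G' \<circ> (\<lambda>h. f x *\<^sub>C h + f' h *\<^sub>C x) = id"
    proof
      fix h
      have f'h: "f' (f x *\<^sub>C h + f' h *\<^sub>C x) = b * f' h"
        by (simp add: f'(2,3) scaleC_complex_def b_def algebra_simps)
      show "(G' \<circ> (\<lambda>h. f x *\<^sub>C h + f' h *\<^sub>C x)) h = id h"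
        unfolding G'_def comp_def f'h using ab
        by (simp add: a_def[symmetric] scaleC_scaleC scaleC_one)
    qed
    have derF: "(F has_derivative (\<lambda>h. f x *\<^sub>C h + f' h *\<^sub>C x)) (at (G y))"
      unfolding F_def Gy by (rule has_derivative_radial[OF f'(1)])
    have contGy: "continuous (at y) G"
      using contG y unfolding continuous_on_eq_continuous_at[OF openFD] by blast
    have FG: "F (G z) = z" if "z \<in> F ` D" for z
      using that GF by auto
    have "(G has_derivative G') (at y)"
      by (rule has_derivative_inverse_basic[OF derF blG' inv contGy openFD y FG])
    with linG' show "\<exists>G'. (G has_derivative G') (at y) \<and> Vector_Spaces.linear scaleC scaleC G'"
      by blast
  qed
  with holF inj openFD show ?thesis
    by (simp add: biholomorphic_map_def F_def G_def)
qed

section \<open>The equivalence, by comparing the ball with its slices\<close>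

theorem theorem3p1:
  fixes f :: "'a::complex_banach \<Rightarrow> complex" and r :: real
  assumes "holomorphic_map f (ball 0 1)"
    and "0 < r" and "r < 1"
  shows "biholomorphic_map (\<lambda>x. f x *\<^sub>C x) (ball 0 r) \<longleftrightarrow>
    (\<forall>u\<in>sphere 0 1. univalent_on (\<lambda>\<zeta>. \<zeta> * f (\<zeta> *\<^sub>C u)) (ball 0 r))"
proof
  have f: "holomorphic_map f (ball 0 r)"
    using assms unfolding holomorphic_map_def by auto
  have slice: "(\<lambda>\<zeta>. \<zeta> * f (\<zeta> *\<^sub>C u)) holomorphic_on ball 0 r" if "norm u = 1" for u
    by (rule holomorphic_on_slice[OF f]) (simp add: norm_scaleC that)
  show "\<forall>u\<in>sphere 0 1. univalent_on (\<lambda>\<zeta>. \<zeta> * f (\<zeta> *\<^sub>C u)) (ball 0 r)"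
    if F: "biholomorphic_map (\<lambda>x. f x *\<^sub>C x) (ball 0 r)"
  proof
    fix u :: 'a assume "u \<in> sphere 0 1"
    then have u: "norm u = 1"
      by simp
    have "inj_on (\<lambda>\<zeta>. \<zeta> * f (\<zeta> *\<^sub>C u)) (ball 0 r)"
    proof (rule inj_onI)
      fix z w assume zw: "z \<in> ball 0 r" "w \<in> ball 0 r" "z * f (z *\<^sub>C u) = w * f (w *\<^sub>C u)"
      then have "f (z *\<^sub>C u) *\<^sub>C z *\<^sub>C u = f (w *\<^sub>C u) *\<^sub>C w *\<^sub>C u"
        by (simp add: scaleC_scaleC mult.commute)
      moreover have "z *\<^sub>C u \<in> ball 0 r" "w *\<^sub>C u \<in> ball 0 r"
        using zw u by (simp_all add: norm_scaleC)
      ultimately have "z *\<^sub>C u = w *\<^sub>C u"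
        using F unfolding biholomorphic_map_def by (meson inj_onD)
      then have "(z - w) *\<^sub>C u = 0"
        by (simp add: scaleC.diff_left)
      then show "z = w"
        using u by (auto simp: scaleC_eq_0_iff)
    qed
    with slice[OF u] show "univalent_on (\<lambda>\<zeta>. \<zeta> * f (\<zeta> *\<^sub>C u)) (ball 0 r)"
      by (simp add: univalent_on_def)
  qed
  show "biholomorphic_map (\<lambda>x. f x *\<^sub>C x) (ball 0 r)"
    if univ: "\<forall>u\<in>sphere 0 1. univalent_on (\<lambda>\<zeta>. \<zeta> * f (\<zeta> *\<^sub>C u)) (ball 0 r)"
  proof (cases "\<exists>u::'a. norm u = 1")
    case False
    \<comment> \<open>The zero space, where nothing is known about the value \<open>f 0\<close>.\<close>
    have zero: "x = 0" for x :: 'a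
      using False by (metis norm_sgn)
    \<comment> \<open>Since every vector is 0, the constant 1 induces the same radial map as
      \<open>f\<close>, and it does not vanish.\<close>
    have "holomorphic_map (\<lambda>x::'a. 1 :: complex) (ball 0 r)"
      unfolding holomorphic_map_def
      by (auto intro!: exI[of _ "\<lambda>_. 0"] simp: linear_scaleC_iff scaleC_complex_def)
    then have "biholomorphic_map (\<lambda>x::'a. 1 *\<^sub>C x) (ball 0 r)"
    proof (rule biholomorphic_map_radial)
      show "inj_on (\<lambda>x::'a. 1 *\<^sub>C x) (ball 0 r)"
        by (simp add: scaleC_one)
      fix x :: 'a and f' :: "'a \<Rightarrow> complex"
      assume "\<And>c h. f' (c *\<^sub>C h) = c *\<^sub>C f' h"
      from this[of 0 0] have "f' 0 = 0"
        by (simp add: scaleC_complex_def scaleC.zero_left)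
      then show "1 + f' x \<noteq> 0"
        using zero[of x] by simp
    qed simp
    moreover have "(\<lambda>x::'a. 1 *\<^sub>C x) = (\<lambda>x. f x *\<^sub>C x)"
    proof
      fix x :: 'a
      show "1 *\<^sub>C x = f x *\<^sub>C x"
        using zero[of x] by (simp add: scaleC.zero_right)
    qed
    ultimately show ?thesis
      by simp
  next
    case True
    have on_line: "\<exists>u z. norm u = 1 \<and> z \<in> ball 0 r \<and> x = z *\<^sub>C u" if "x \<in> ball 0 r" for x :: 'a
    proof (cases "x = 0")
      case True
      with \<open>\<exists>u::'a. norm u = 1\<close> \<open>0 < r\<close> show ?thesis
        by (metis centre_in_ball scaleC.zero_left)
    next
      case False
      then have "x = complex_of_real (norm x) *\<^sub>C sgn x"
        by (simp add: scaleR_scaleC[symmetric] sgn_div_norm)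
      with False that show ?thesis
        by (intro exI[of _ "sgn x"] exI[of _ "complex_of_real (norm x)"]) (simp add: norm_sgn)
    qed
    have inj_slice: "inj_on (\<lambda>\<zeta>. \<zeta> * f (\<zeta> *\<^sub>C u)) (ball 0 r)" if "norm u = 1" for u
      using univ that by (simp add: univalent_on_def)
    have reg: "f x + f' x \<noteq> 0" if "x \<in> ball 0 r" and f': "(f has_derivative f') (at x)"
      "\<And>c h. f' (c *\<^sub>C h) = c *\<^sub>C f' h" for x f'
    proof -
      obtain u z where u: "norm u = 1" "z \<in> ball 0 r" "x = z *\<^sub>C u"
        using on_line \<open>x \<in> ball 0 r\<close> by blast
      have "deriv (\<lambda>\<zeta>. \<zeta> * f (\<zeta> *\<^sub>C u)) z = f x + f' x"
        using has_field_derivative_slice[of f f' z u] f' u(3) by (simp add: DERIV_imp_deriv)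
      \<comment> \<open>An injective holomorphic function of one variable has nowhere vanishing
        derivative.\<close>
      then show ?thesis
        using holomorphic_injective_imp_regular[OF slice[OF u(1)] open_ball inj_slice[OF u(1)] u(2)]
        by simp
    qed
    \<comment> \<open>At the origin \<open>f' 0 = 0\<close> reduces \<open>reg\<close> to the claim.
      Elsewhere the slice is injective and already takes the value 0 at 0.\<close>
    have nz: "f x \<noteq> 0" if x: "x \<in> ball 0 r" for x
    proof (cases "x = 0")
      case True
      obtain f' where f': "(f has_derivative f') (at x)" "\<And>c h. f' (c *\<^sub>C h) = c *\<^sub>C f' h"
        by (metis holomorphic_mapE[OF f x])
      have "f' 0 = 0"
        using f'(2)[of 0 0] by (simp add: scaleC_complex_def scaleC.zero_left)
      with reg[OF x f'] True show ?thesis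
        by simp
    next
      case False
      obtain u z where u: "norm u = 1" "z \<in> ball 0 r" "x = z *\<^sub>C u"
        using on_line x by blast
      have "z \<noteq> 0"
        using False u(3) by (auto simp: scaleC.zero_left)
      then have "z * f (z *\<^sub>C u) \<noteq> 0 * f (0 *\<^sub>C u)"
        using inj_onD[OF inj_slice[OF u(1)], of z 0] u(2) \<open>0 < r\<close> by auto
      with u(3) show ?thesis
        by auto
    qed
    have "inj_on (\<lambda>x. f x *\<^sub>C x) (ball 0 r)"
    proof (rule inj_onI)
      fix x y assume xy: "x \<in> ball 0 r" "y \<in> ball 0 r" "f x *\<^sub>C x = f y *\<^sub>C y"
      obtain u z where u: "norm u = 1" "z \<in> ball 0 r" "x = z *\<^sub>C u"
        using on_line xy(1) by blast
      \<comment> \<open>Equal images force \<open>y\<close> onto the complex line of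
        \<open>x\<close>, with this coordinate; injectivity of a single slice then decides.\<close>
      define w where "w = f x * z / f y"
      have "y = (1 / f y) *\<^sub>C f y *\<^sub>C y"
        using nz[OF xy(2)] by (simp add: scaleC_scaleC scaleC_one)
      then have y: "y = w *\<^sub>C u"
        by (simp add: xy(3)[symmetric] u(3) scaleC_scaleC w_def)
      have "z * f (z *\<^sub>C u) = w * f (w *\<^sub>C u)"
        using nz[OF xy(2)] unfolding y[symmetric] u(3)[symmetric] by (simp add: w_def)
      moreover have "w \<in> ball 0 r"
        using xy(2) u(1) by (simp add: y norm_scaleC)
      ultimately have "z = w"
        using inj_slice[OF u(1)] u(2) by (meson inj_onD)
      with y u(3) show "x = y"
        by simp
    qed
    then show ?thesis
      using nz reg by (rule biholomorphic_map_radial[OF f])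
  qed
qed

end
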